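(* Let $\lambda>0$, let $(M,d)$ be a nonempty $\lambda$-hyperconvex metric space, and let $T:M\to M$ be an $L$-Lipschitzian involution, i.e. $T(Tx)=x$ for all $x\in M$ and $d(Tx,Ty)\le L\,d(x,y)$ for all $x,y\in M$, where $0<L<\frac{2}{\lambda^2}$. Then the fixed point set $\operatorname{Fix} T=\{x\in M: Tx=x\}$ is nonempty.
   Context: $B(x,r)=\{y\in M: d(x,y)\le r\}$ denotes a closed ball. A subset $D$ of a metric space $M$ is called admissible if it is an intersection of closed balls. A metric space $(M,d)$ is $\lambda$-hyperconvex if for every nonempty admissible set $D\subset M$ and for any family of closed balls $\{B(x_\alpha,r_\alpha)\}_{\alpha\in\Gamma}$ (with $r_\alpha\ge 0$) centered at points $x_\alpha\in D$, $\alpha\in\Gamma$, such that $d(x_\alpha,x_\beta)\le r_\alpha+r_\beta$ for all $\alpha,\beta\in\Gamma$, one has $D\cap\bigcap_{\alpha\in\Gamma}B(x_\alpha,\lambda r_\alpha)\neq\emptyset$. *)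

theory Defs
  imports "HOL-Analysis.Abstract_Metric_Spaces"
begin

context Metric_space
begin

text \<open>
  Families of balls are represented by sets of pairs (centre, radius); repetitions in an indexed
  family affect neither the intersection nor the pairwise distance condition.

  Intersections are taken over nonempty families, so an unbounded space is not admissible in
  itself. Counting the whole space as admissible would only strengthen the hyperconvexity
  condition below.
\<close>

definition admissible :: "'a set \<Rightarrow> bool" where
  "admissible D \<longleftrightarrow>
     (\<exists>F. F \<noteq> {} \<and> F \<subseteq> M \<times> {0..} \<and> D = (\<Inter>(x, r)\<in>F. mcball x r))"

definition hyperconvex_with :: "real \<Rightarrow> bool" where
  "hyperconvex_with c \<longleftrightarrow>
     (\<forall>D F. admissible D \<longrightarrow> D \<noteq> {} \<longrightarrow> F \<subseteq> D \<times> {0..} \<longrightarrow>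
        (\<forall>(x, r)\<in>F. \<forall>(y, s)\<in>F. d x y \<le> r + s) \<longrightarrow>
        D \<inter> (\<Inter>(x, r)\<in>F. mcball x (c * r)) \<noteq> {})"

end

end

theory Submission
  imports Defs
begin

text \<open>
  Given \<open>x\<close>, hyperconvexity yields an approximate midpoint \<open>z\<close> of \<open>x\<close> and \<open>T x\<close> lying in every
  closed ball that contains both. Since \<open>T\<close> swaps \<open>x\<close> and \<open>T x\<close>, the point \<open>T z\<close> is within
  \<open>(L c / 2) d(x, T x)\<close> of both of them, so \<open>z\<close> lies in the ball of that radius around \<open>T z\<close>.
  As \<open>c \<ge> 1\<close> whenever \<open>M\<close> has two points, the factor \<open>L c / 2\<close> is less than 1; iterating gives a
  sequence with geometrically decreasing steps, whose limit, again provided by hyperconvexity, is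
  fixed by \<open>T\<close>.
\<close>

context Metric_space
begin

lemma hyperconvex_withD:
  assumes "hyperconvex_with c" "admissible D" "D \<noteq> {}" "F \<subseteq> D \<times> {0..}"
    and "\<And>x r y s. (x, r) \<in> F \<Longrightarrow> (y, s) \<in> F \<Longrightarrow> d x y \<le> r + s"
  shows "\<exists>z\<in>D. \<forall>(x, r)\<in>F. z \<in> mcball x (c * r)"
proof -
  have "D \<inter> (\<Inter>(x, r)\<in>F. mcball x (c * r)) \<noteq> {}"
    using assms(1)[unfolded hyperconvex_with_def, rule_format, OF assms(2-4)] assms(5) by auto
  then show ?thesis
    by (auto simp del: in_mcball)
qed

lemma admissible_mcball:
  assumes "x \<in> M" "0 \<le> r"
  shows "admissible (mcball x r)"
  unfolding admissible_def using assms by (intro exI[of _ "{(x, r)}"]) auto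

text \<open>Hyperconvexity is applied to the two balls of radius \<open>d x y / 2\<close> about
  \<open>x\<close> and \<open>y\<close>, inside the intersection of all closed balls containing both
  points. The last conclusion records membership in that hull.\<close>

lemma hyperconvex_midpoint:
  assumes hyp: "hyperconvex_with c" and x: "x \<in> M" and y: "y \<in> M"
  obtains z where "z \<in> M" "d x z \<le> c * (d x y / 2)" "d y z \<le> c * (d x y / 2)"
    "\<And>p s. p \<in> M \<Longrightarrow> d p x \<le> s \<Longrightarrow> d p y \<le> s \<Longrightarrow> d p z \<le> s"
proof -
  define G where "G = {(p, s). p \<in> M \<and> d p x \<le> s \<and> d p y \<le> s}"
  define D where "D = (\<Inter>(p, s)\<in>G. mcball p s)"
  \<comment> \<open>An admissible set needs a nonempty family of balls, and this is a
    member.\<close>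
  have "(x, d x y) \<in> G"
    using x by (simp add: G_def)
  moreover have "G \<subseteq> M \<times> {0..}"
    by (auto simp: G_def intro: order_trans[OF nonneg])
  ultimately have adm: "admissible D"
    unfolding admissible_def D_def by blast
  have xyD: "x \<in> D" "y \<in> D"
    using x y by (auto simp: D_def G_def)
  have "\<exists>z\<in>D. \<forall>(u, r)\<in>{x, y} \<times> {d x y / 2}. z \<in> mcball u (c * r)"
  proof (rule hyperconvex_withD[OF hyp adm])
    show "D \<noteq> {}" "{x, y} \<times> {d x y / 2} \<subseteq> D \<times> {0..}"
      using xyD by auto
    show "d u v \<le> r + s"
      if "(u, r) \<in> {x, y} \<times> {d x y / 2}" "(v, s) \<in> {x, y} \<times> {d x y / 2}" for u v r s
    proof -
      have "d u v \<le> d x y"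
        using that x y by (auto simp: commute)
      moreover have "r = d x y / 2" "s = d x y / 2"
        using that by auto
      ultimately show ?thesis
        by linarith
    qed
  qed
  then obtain z where zD: "z \<in> D"
    and z: "z \<in> mcball x (c * (d x y / 2))" "z \<in> mcball y (c * (d x y / 2))"
    by blast
  have "d p z \<le> s" if "p \<in> M" "d p x \<le> s" "d p y \<le> s" for p s
    using zD that by (auto simp: D_def G_def)
  with z show thesis
    by (intro that[of z]) auto
qed

text \<open>The path from \<open>x\<close> to \<open>y\<close> through the approximate midpoint has
  length at most \<open>c * d x y\<close>.\<close>

lemma hyperconvex_const_ge_1:
  assumes "hyperconvex_with c" "x \<in> M" "y \<in> M" "x \<noteq> y"
  shows "1 \<le> c"
proof -
  obtain z where "z \<in> M" "d x z \<le> c * (d x y / 2)" "d y z \<le> c * (d x y / 2)"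
    using hyperconvex_midpoint assms by metis
  then have "d x y \<le> c * d x y"
    using triangle[of x z y] assms(2,3) commute[of z y] by linarith
  moreover have "0 < d x y"
    using assms by simp
  ultimately show ?thesis
    by (simp del: mdist_pos_eq mdist_pos_less)
qed

text \<open>Hyperconvexity stands in for completeness: balls about the \<open>X n\<close> with radii
  bounding the tails meet after enlargement by \<open>c\<close>, and a common point is the limit
  because the radii tend to 0.\<close>

lemma hyperconvex_geometric_limit:
  assumes hyp: "hyperconvex_with c" and X: "\<And>n. X n \<in> M"
    and k: "0 \<le> k" "k < 1" and A: "0 \<le> A"
    and step: "\<And>n. d (X n) (X (Suc n)) \<le> A * k ^ n"
  obtains z where "z \<in> M" "(\<lambda>n. d (X n) z) \<longlonglongrightarrow> 0"
proof -
  \<comment> \<open>\<open>C * k ^ n\<close> is the sum of the steps \<open>A * k ^ m\<close> over m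
    \<ge> n; the identity \<open>A + C * k = C\<close> drives the induction for
    \<open>tail\<close>.\<close>
  define C where "C = A / (1 - k)"
  have C: "0 \<le> C" "A + C * k = C"
    using k A by (simp_all add: C_def field_simps)
  have tail: "d (X n) (X (n + m)) \<le> C * k ^ n" for n m
  proof (induction m arbitrary: n)
    case 0
    then show ?case
      using X C k by simp
  next
    case (Suc m)
    have "d (X n) (X (n + Suc m)) \<le> d (X n) (X (Suc n)) + d (X (Suc n)) (X (Suc n + m))"
      using triangle[OF X X X] by simp
    also have "\<dots> \<le> A * k ^ n + C * k ^ Suc n"
      using step Suc.IH by (intro add_mono)
    also have "\<dots> = (A + C * k) * k ^ n"
      by (simp add: algebra_simps)
    finally show ?case
      using C by simp
  qed
  have pair: "d (X n) (X m) \<le> C * k ^ n + C * k ^ m" for n m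
  proof (cases "n \<le> m")
    case True
    then show ?thesis
      using tail[of n "m - n"] C k by (simp add: add_increasing2)
  next
    case False
    then show ?thesis
      using tail[of m "n - m"] C k commute[of "X n" "X m"] by (simp add: add_increasing)
  qed
  \<comment> \<open>This ball serves as the admissible set that has to contain all centres.\<close>
  have X0: "X n \<in> mcball (X 0) C" for n
    using tail[of 0 n] X by simp
  have "\<exists>z\<in>mcball (X 0) C. \<forall>(u, r)\<in>range (\<lambda>n. (X n, C * k ^ n)). z \<in> mcball u (c * r)"
  proof (rule hyperconvex_withD[OF hyp admissible_mcball[OF X C(1)]])
    show "mcball (X 0) C \<noteq> {}"
      using X0 by blast
    show "range (\<lambda>n. (X n, C * k ^ n)) \<subseteq> mcball (X 0) C \<times> {0..}"
      using X0 C k by (auto simp del: in_mcball)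
  qed (use pair in auto)
  then obtain z where zM: "z \<in> mcball (X 0) C"
    and z: "\<And>n. d (X n) z \<le> c * (C * k ^ n)"
    by auto
  have "(\<lambda>n. c * (C * k ^ n)) \<longlonglongrightarrow> 0"
    using k by (intro tendsto_mult_right_zero LIMSEQ_power_zero) simp
  then have "(\<lambda>n. d (X n) z) \<longlonglongrightarrow> 0"
    by (rule Lim_null_comparison[rotated]) (use z in auto)
  with zM show thesis
    by (intro that[of z]) auto
qed

lemma involution_midpoint:
  assumes hyp: "hyperconvex_with c"
    and T: "T \<in> M \<rightarrow> M" and inv: "\<And>x. x \<in> M \<Longrightarrow> T (T x) = x"
    and lip: "\<And>x y. x \<in> M \<Longrightarrow> y \<in> M \<Longrightarrow> d (T x) (T y) \<le> L * d x y"
    and L: "0 \<le> L" and x: "x \<in> M"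
  shows "\<exists>z\<in>M. d z (T z) \<le> L * c / 2 * d x (T x) \<and> d x z \<le> c / 2 * d x (T x)"
proof -
  have Tx: "T x \<in> M"
    using T x by blast
  obtain z where z: "z \<in> M" "d x z \<le> c * (d x (T x) / 2)" "d (T x) z \<le> c * (d x (T x) / 2)"
    and hull: "\<And>p s. p \<in> M \<Longrightarrow> d p x \<le> s \<Longrightarrow> d p (T x) \<le> s \<Longrightarrow> d p z \<le> s"
    using hyperconvex_midpoint[OF hyp x Tx] by metis
  have "d (T z) (T x) \<le> L * d x z" "d (T z) x \<le> L * d (T x) z"
    using lip[OF z(1) x] lip[OF z(1) Tx] inv[OF x] by (simp_all add: commute)
  then have "d (T z) (T x) \<le> L * (c * (d x (T x) / 2))" "d (T z) x \<le> L * (c * (d x (T x) / 2))"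
    using z L by (meson mult_left_mono order_trans)+
  \<comment> \<open>\<open>T z\<close> is taken as the centre \<open>p\<close> in
    \<open>hull\<close>: a ball about it contains \<open>x\<close> and \<open>T x\<close>, hence
    also \<open>z\<close>.\<close>
  then have "d (T z) z \<le> L * (c * (d x (T x) / 2))"
    using hull T z(1) by blast
  then show ?thesis
    using z by (intro bexI[of _ z]) (simp_all add: commute)
qed

lemma lipschitz_involution_fixpoint:
  assumes hyp: "hyperconvex_with c" and ne: "M \<noteq> {}" and c: "0 < c"
    and T: "T \<in> M \<rightarrow> M" and inv: "\<And>x. x \<in> M \<Longrightarrow> T (T x) = x"
    and lip: "\<And>x y. x \<in> M \<Longrightarrow> y \<in> M \<Longrightarrow> d (T x) (T y) \<le> L * d x y"
    and L: "0 \<le> L" "L * c < 2"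
  shows "\<exists>x\<in>M. T x = x"
proof -
  define k where "k = L * c / 2"
  have k: "0 \<le> k" "k < 1"
    using L c by (simp_all add: k_def)
  \<comment> \<open>\<open>S\<close> chooses an approximate midpoint of \<open>x\<close> and
    \<open>T x\<close>; its orbit from \<open>a\<close> is the sequence \<open>X\<close>.\<close>
  obtain S where S: "S x \<in> M" "d (S x) (T (S x)) \<le> k * d x (T x)" "d x (S x) \<le> c / 2 * d x (T x)"
    if "x \<in> M" for x
    using involution_midpoint[OF hyp T inv lip L(1)] unfolding k_def by metis
  obtain a where a: "a \<in> M"
    using ne by blast
  define X where "X n = (S ^^ n) a" for n
  have XM: "X n \<in> M" for n
    unfolding X_def by (induction n) (simp_all add: a S)
  have decay: "d (X n) (T (X n)) \<le> d a (T a) * k ^ n" for n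
  proof (induction n)
    case 0
    then show ?case
      by (simp add: X_def)
  next
    case (Suc n)
    have "d (X (Suc n)) (T (X (Suc n))) \<le> k * d (X n) (T (X n))"
      using S(2)[OF XM[of n]] by (simp add: X_def)
    also have "\<dots> \<le> k * (d a (T a) * k ^ n)"
      using Suc k by (intro mult_left_mono)
    finally show ?case
      by (simp add: mult_ac)
  qed
  have step: "d (X n) (X (Suc n)) \<le> c / 2 * d a (T a) * k ^ n" for n
  proof -
    have "d (X n) (X (Suc n)) \<le> c / 2 * d (X n) (T (X n))"
      using S(3)[OF XM[of n]] by (simp add: X_def)
    also have "\<dots> \<le> c / 2 * (d a (T a) * k ^ n)"
      using decay c by (intro mult_left_mono) simp_all
    finally show ?thesis
      by (simp add: mult_ac)
  qed
  have "0 \<le> c / 2 * d a (T a)"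
    using c by simp
  then obtain z where z: "z \<in> M" and lim: "(\<lambda>n. d (X n) z) \<longlonglongrightarrow> 0"
    by (rule hyperconvex_geometric_limit[where X = X, OF hyp XM k _ step])
  have TM: "T x \<in> M" if "x \<in> M" for x
    using T that by blast
  \<comment> \<open>Passing through \<open>X n\<close> and \<open>T (X n)\<close> bounds the
    displacement of \<open>z\<close> by three terms that vanish in the limit.\<close>
  have "d z (T z) \<le> d (X n) z + d a (T a) * k ^ n + L * d (X n) z" for n
  proof -
    have "d z (T z) \<le> d z (X n) + (d (X n) (T (X n)) + d (T (X n)) (T z))"
      using triangle[of z "X n" "T z"] triangle[of "X n" "T (X n)" "T z"] z XM TM
      by (meson add_left_mono order_trans)
    then show ?thesis
      using decay[of n] lip[OF XM z, of n] by (simp add: commute)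
  qed
  moreover have "(\<lambda>n. d (X n) z + d a (T a) * k ^ n + L * d (X n) z) \<longlonglongrightarrow> 0"
    using k lim by (intro tendsto_add_zero tendsto_mult_right_zero LIMSEQ_power_zero) simp_all
  ultimately have "d z (T z) \<le> 0"
    by (intro LIMSEQ_le_const) auto
  then have "T z = z"
    using z TM nonneg[of z "T z"] zero[of z "T z"] by simp
  then show ?thesis
    using z by blast
qed

end

theorem theorem2p11:
  fixes M :: "'a set" and d :: "'a \<Rightarrow> 'a \<Rightarrow> real"
    and T :: "'a \<Rightarrow> 'a" and c L :: real
  assumes "Metric_space M d"
    and "M \<noteq> {}"
    and "c > 0"
    and "Metric_space.hyperconvex_with M d c"
    and "T \<in> M \<rightarrow> M"
    and "\<And>x. x \<in> M \<Longrightarrow> T (T x) = x"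
    and "\<And>x y. x \<in> M \<Longrightarrow> y \<in> M \<Longrightarrow> d (T x) (T y) \<le> L * d x y"
    and "0 < L" and "L < 2 / c\<^sup>2"
  shows "{x \<in> M. T x = x} \<noteq> {}"
proof
  assume no_fix: "{x \<in> M. T x = x} = {}"
  interpret Metric_space M d
    by fact
  obtain a where "a \<in> M"
    using \<open>M \<noteq> {}\<close> by blast
  \<comment> \<open>The absence of fixed points makes \<open>a\<close> and \<open>T a\<close>
    distinct. A one-point space would not force this bound, hence the argument by
    contradiction.\<close>
  then have "1 \<le> c"
    using hyperconvex_const_ge_1[of c a "T a"] assms(4,5) no_fix by fastforce
  then have "L * c \<le> L * c\<^sup>2"
    using \<open>0 < L\<close> by (simp add: power2_eq_square)
  also have "\<dots> < 2"
    using \<open>L < 2 / c\<^sup>2\<close> \<open>0 < c\<close> by (simp add: field_simps)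
  finally have "\<exists>x\<in>M. T x = x"
    using lipschitz_involution_fixpoint[of c T L] assms by simp
  then show False
    using no_fix by blast
qed

end
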